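(* Let $p$ be a prime, let $r\in\mathbb{C}_p$ with $|r-1|<1$, and define $\Gamma_p(-,r) = \overline{\gamma}_r$, where $\overline{\gamma}_r:\mathbb{Z}_p\to\mathbb{C}_p$ is $\overline{\gamma}_r(x) = \exp(r\tilde{p})\,\gamma_r(x-1)$. Then for all $s\in\mathbb{Z}_p$, $$\Gamma_p(s,r) = \exp(r\tilde{p})\,r^s\int_{\mathbb{Z}_p}\Big((\mathbf{1}-\beta_1)^{\star(s-1)}\star g_r\Big)\,d\mu(H_{\mathbf{1}}) .$$
   Context: $C(\mathbb{Z}_p,\mathbb{C}_p)$ is the $\mathbb{C}_p$-vector space of continuous functions $\mathbb{Z}_p \to \mathbb{C}_p$, and $\mathscr{S}$ is the $\mathbb{C}_p$-linear automorphism of it given by $\mathscr{S}(\phi)(x) = \phi(x) - x\phi(x-1)$. For $r\in\mathbb{C}_p$ with $|r-1|<1$, $g_r:\mathbb{Z}_p\to\mathbb{C}_p$ is $g_r(x) = r^x = \sum_{n\ge0}(r-1)^n\binom{x}{n}$, and $\gamma_r = \mathscr{S}^{-1}(g_r)$. Here $\tilde{p}=p$ if $p$ is odd, $\tilde{p}=4$ if $p=2$, and $\exp$ is the $p$-adic exponential series. For $n\ge0$, $\beta_n(x) = \binom{x}{n}$ (so $\beta_1(x)=x$), and $\mathbf{1}$ is the constant function $1$. Every $\phi \in C(\mathbb{Z}_p,\mathbb{C}_p)$ is uniquely $\sum_{n\ge0}a_n\beta_n$ with $a_n \in \mathbb{C}_p$, $a_n\to0$ (Mahler coefficients). A power series $G(t)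 = \sum_{n\ge0}b_nt^n \in \mathbb{C}_p[[t]]$ with bounded coefficients defines a measure (bounded linear functional) $\mu(G)$ by $\int_{\mathbb{Z}_p}\phi\,d\mu(G) = \sum_{n\ge0}a_nb_n$, where $(a_n)$ are the Mahler coefficients of $\phi$. For $\psi \in C(\mathbb{Z}_p,\mathbb{C}_p)$, $H_\psi(t) = \sum_{n\ge0}(-1)^n\psi(-1-n)t^n$. The product $\star$ on $C(\mathbb{Z}_p,\mathbb{C}_p)$ is $\phi\star\psi = \sum_{n\ge0}\big(\sum_{k=0}^n\binom{n}{k}a_kb_{n-k}\big)\beta_n$, where $(a_k),(b_l)$ are the Mahler coefficients of $\phi,\psi$. For $s\in\mathbb{Z}_p$, $(\mathbf{1}-\beta_1)^{\star s}$ is defined to be the continuous function $\sum_{n=0}^\infty(-1)^n\binom{s}{n}n!\,\beta_n$. *)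

theory Defs
  imports
    "HOL-Analysis.Elementary_Metric_Spaces"
    "HOL-Computational_Algebra.Formal_Power_Series"
    "HOL-Computational_Algebra.Polynomial"
    "HOL-Computational_Algebra.Primes"
    "HOL-Library.FuncSet"
begin

definition padic_abs :: "'a::{zero,metric_space} \<Rightarrow> real"
  where "padic_abs x = dist x 0"

text \<open>Inside a complete field extending the rationals with their p-adic absolute value, the
  closures of the rationals and of the integers are the completions, i.e. the p-adic numbers and
  the p-adic integers.\<close>

definition Qp :: "'a::{field_char_0,metric_space} set"
  where "Qp = closure \<rat>"

definition Zp :: "'a::{field_char_0,metric_space} set"
  where "Zp = closure \<int>"

definition Qp_algebraic :: "'a::{field_char_0,metric_space} set"
  where "Qp_algebraic = {x. \<exists>f. f \<noteq> 0 \<and> (\<forall>i. coeff f i \<in> Qp) \<and> poly f x = 0}"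

text \<open>The type \<^typ>\<open>'a\<close> is the completion of an algebraic closure of the p-adic numbers.
  This determines the field with its absolute value up to isometric isomorphism. On the rationals
  the absolute value is the p-adic one: it is non-archimedean, multiplicative and sends p
  to 1/p.\<close>

locale padic_complex_numbers =
  fixes p :: nat and K :: "'a::{field_char_0,metric_space} itself"
  assumes dist_eq: "dist (x::'a) y = padic_abs (x - y)"
    and abs_mult: "padic_abs (x * y :: 'a) = padic_abs x * padic_abs y"
    and abs_add: "padic_abs (x + y :: 'a) \<le> max (padic_abs x) (padic_abs y)"
    and abs_p: "padic_abs (of_nat p :: 'a) = 1 / real p"
    and complete: "complete (UNIV :: 'a set)"
    and alg_closed:
      "\<lbrakk>\<forall>i. coeff f i \<in> Qp_algebraic; degree f > 0\<rbrakk> \<Longrightarrow> \<exists>x::'a\<in>Qp_algebraic. poly f x = 0"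
    and dense: "closure (Qp_algebraic :: 'a set) = UNIV"

text \<open>Functions on the p-adic integers are extensional: they are \<^const>\<open>undefined\<close> off
  \<^const>\<open>Zp\<close>, so that equality in this set is equality of functions on the p-adic integers.\<close>

definition C_Zp :: "('a::{field_char_0,metric_space} \<Rightarrow> 'a) set"
  where "C_Zp = {\<phi> \<in> extensional Zp. continuous_on Zp \<phi>}"

definition S_op :: "('a::{field_char_0,metric_space} \<Rightarrow> 'a) \<Rightarrow> 'a \<Rightarrow> 'a"
  where "S_op \<phi> = (\<lambda>x\<in>Zp. \<phi> x - x * \<phi> (x - 1))"

definition g_fun :: "'a::{field_char_0,metric_space} \<Rightarrow> 'a \<Rightarrow> 'a"
  where "g_fun r = (\<lambda>x\<in>Zp. \<Sum>n. (r - 1) ^ n * (x gchoose n))"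

definition gamma_fun :: "'a::{field_char_0,metric_space} \<Rightarrow> 'a \<Rightarrow> 'a"
  where "gamma_fun r = inv_into C_Zp S_op (g_fun r)"

definition p_tilde :: "nat \<Rightarrow> nat"
  where "p_tilde p = (if p = 2 then 4 else p)"

definition padic_exp :: "'a::{field_char_0,metric_space} \<Rightarrow> 'a"
  where "padic_exp x = (\<Sum>n. x ^ n / fact n)"

definition padic_Gamma :: "nat \<Rightarrow> 'a::{field_char_0,metric_space} \<Rightarrow> 'a \<Rightarrow> 'a"
  where "padic_Gamma p r = (\<lambda>x\<in>Zp. padic_exp (r * of_nat (p_tilde p)) * gamma_fun r (x - 1))"

definition mahler_coeff :: "('a::{field_char_0,metric_space} \<Rightarrow> 'a) \<Rightarrow> nat \<Rightarrow> 'a"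
  where "mahler_coeff \<phi> =
    (THE a. a \<longlonglongrightarrow> 0 \<and> (\<forall>x\<in>Zp. (\<lambda>n. a n * (x gchoose n)) sums \<phi> x))"

text \<open>The integral of \<open>\<phi>\<close> against the measure attached to \<open>G\<close>; meant for \<open>G\<close> with bounded
  coefficients and \<open>\<phi>\<close> in \<^const>\<open>C_Zp\<close>.\<close>

definition integral_mu :: "'a::{field_char_0,metric_space} fps \<Rightarrow> ('a \<Rightarrow> 'a) \<Rightarrow> 'a"
  where "integral_mu G \<phi> = (\<Sum>n. mahler_coeff \<phi> n * fps_nth G n)"

definition H_fps :: "('a::{field_char_0,metric_space} \<Rightarrow> 'a) \<Rightarrow> 'a fps"
  where "H_fps \<psi> = Abs_fps (\<lambda>n. (- 1) ^ n * \<psi> (- 1 - of_nat n))"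

definition const_one :: "'a::{field_char_0,metric_space} \<Rightarrow> 'a"
  where "const_one = (\<lambda>x\<in>Zp. 1)"

definition star :: "('a::{field_char_0,metric_space} \<Rightarrow> 'a) \<Rightarrow> ('a \<Rightarrow> 'a) \<Rightarrow> 'a \<Rightarrow> 'a"
    (infixl "\<star>" 70)
  where "\<phi> \<star> \<psi> = (\<lambda>x\<in>Zp. \<Sum>n.
    (\<Sum>k=0..n. of_nat (n choose k) * mahler_coeff \<phi> k * mahler_coeff \<psi> (n - k)) * (x gchoose n))"

text \<open>The star power of \<open>1 - \<beta>\<^sub>1\<close> with a p-adic integer exponent \<open>s\<close>.\<close>

definition one_minus_beta1_star_power :: "'a::{field_char_0,metric_space} \<Rightarrow> 'a \<Rightarrow> 'a"
  where "one_minus_beta1_star_power s =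
    (\<lambda>x\<in>Zp. \<Sum>n. (- 1) ^ n * (s gchoose n) * fact n * (x gchoose n))"

end

theory Submission
  imports Defs "HOL-Analysis.Uniform_Limit"
begin

text \<open>Put \<open>u = 1 - r\<close>, so that \<open>\<bar>u\<bar> < 1\<close>. Under the star product the Mahler series with
  coefficients \<open>a\<^sub>n\<close> corresponds to the exponential generating function \<open>\<Sum> a\<^sub>n t\<^sup>n / n!\<close>, and
  integration against \<open>\<mu>(H\<^sub>1)\<close> is \<open>\<Sum> (-1)\<^sup>n a\<^sub>n\<close>. The function
  \<open>(1 - \<beta>\<^sub>1)\<^sup>\<star>\<^sup>x \<star> g\<^sub>r\<close> corresponds to \<open>(1 - t)\<^sup>x exp ((r - 1) t)\<close>, so its integral is
  \<open>I(x) = \<Sum> d\<^sub>n(x)\<close>, where the \<open>d\<^sub>n(x)\<close> are the coefficients of the exponential generating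
  function \<open>f\<^sub>x(t) = (1 + t)\<^sup>x exp (u t)\<close>. It is the p-adic counterpart of
  \<open>\<integral>\<^sub>0\<^sup>\<infinity> (1 + t)\<^sup>x exp (- r t) dt\<close>.

  Integration by parts becomes a recursion of coefficients: \<open>f\<^sub>x' = x f\<^bsub>x-1\<^esub> + u f\<^sub>x\<close> says
  \<open>d\<^bsub>n+1\<^esub>(x) = x d\<^sub>n(x - 1) + u d\<^sub>n(x)\<close>, and summation over \<open>n\<close> gives
  \<open>r I(x) = 1 + x I(x - 1)\<close> (\<open>moment_series_functional_equation\<close>). With
  \<open>r\<^sup>x\<^sup>+\<^sup>1 = r r\<^sup>x\<close> it follows that \<open>F(x) = r\<^sup>x\<^sup>+\<^sup>1 I(x)\<close> satisfies
  \<open>F(x) - x F(x - 1) = r\<^sup>x\<close>. Both factors of \<open>F\<close> are uniformly convergent series of polynomials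
  on the p-adic integers, because \<open>n! \<rightarrow> 0\<close> and \<open>u\<^sup>n \<rightarrow> 0\<close>; so \<open>F\<close> is continuous. Finally
  \<open>\<phi>(x) = x \<phi>(x - 1)\<close> forces \<open>\<phi>\<close> to vanish on the natural numbers, which are dense, hence
  \<open>S_op\<close> is injective on continuous functions and \<open>F = \<gamma>\<^sub>r\<close>. Evaluating at \<open>x = s - 1\<close>
  yields the formula.\<close>

section \<open>Combinatorics and real sequences\<close>

text \<open>This is the product rule for exponential generating functions: if \<open>Q\<close> has coefficients
  \<open>q k\<close>, then the derivative of \<open>Q(t) exp (u t)\<close> is \<open>u Q(t) exp (u t) + Q'(t) exp (u t)\<close>.\<close>

lemma binomial_convolution_Suc:
  fixes q :: "nat \<Rightarrow> 'a::comm_ring_1"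
  shows "(\<Sum>k\<le>Suc n. of_nat (Suc n choose k) * q k * u ^ (Suc n - k)) =
    u * (\<Sum>k\<le>n. of_nat (n choose k) * q k * u ^ (n - k)) +
    (\<Sum>k\<le>n. of_nat (n choose k) * q (Suc k) * u ^ (n - k))"
proof -
  have "u * (\<Sum>k\<le>n. of_nat (n choose k) * q k * u ^ (n - k)) =
      (\<Sum>k\<le>n. of_nat (n choose k) * q k * u ^ (Suc n - k))"
    by (auto simp: sum_distrib_left Suc_diff_le intro!: sum.cong)
  also have "\<dots> = (\<Sum>k\<le>Suc n. of_nat (n choose k) * q k * u ^ (Suc n - k))"
    by (simp add: binomial_eq_0)
  also have "\<dots> = q 0 * u ^ Suc n + (\<Sum>k\<le>n. of_nat (n choose Suc k) * q (Suc k) * u ^ (n - k))"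
    by (subst sum.atMost_Suc_shift) simp
  finally have *: "u * (\<Sum>k\<le>n. of_nat (n choose k) * q k * u ^ (n - k)) =
      q 0 * u ^ Suc n + (\<Sum>k\<le>n. of_nat (n choose Suc k) * q (Suc k) * u ^ (n - k))" .
  have "(\<Sum>k\<le>Suc n. of_nat (Suc n choose k) * q k * u ^ (Suc n - k)) =
      q 0 * u ^ Suc n + (\<Sum>k\<le>n. of_nat (Suc n choose Suc k) * q (Suc k) * u ^ (n - k))"
    by (subst sum.atMost_Suc_shift) simp
  then show ?thesis
    unfolding * by (simp add: algebra_simps sum.distrib)
qed

definition max_convolution :: "(nat \<Rightarrow> real) \<Rightarrow> (nat \<Rightarrow> real) \<Rightarrow> nat \<Rightarrow> real"
  where "max_convolution \<alpha> \<beta> n = Max ((\<lambda>k. \<alpha> k * \<beta> (n - k)) ` {..n})"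

lemma le_max_convolution: "k \<le> n \<Longrightarrow> \<alpha> k * \<beta> (n - k) \<le> max_convolution \<alpha> \<beta> n"
  by (auto simp: max_convolution_def intro!: Max_ge)

text \<open>For \<open>n \<ge> 2 N\<close> and \<open>k \<le> n\<close> one of \<open>k\<close>, \<open>n - k\<close> is at least \<open>N\<close>, so one factor is small
  while the other one is bounded.\<close>

lemma max_convolution_null:
  assumes "\<alpha> \<longlonglongrightarrow> 0" "\<beta> \<longlonglongrightarrow> 0" and nonneg: "\<And>n. 0 \<le> \<alpha> n" "\<And>n. 0 \<le> \<beta> n"
  shows "max_convolution \<alpha> \<beta> \<longlonglongrightarrow> 0"
proof (rule LIMSEQ_I)
  fix e :: real
  assume e: "e > 0"
  have "Bseq \<alpha>" "Bseq \<beta>"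
    using assms(1,2) by (auto intro: convergent_imp_Bseq convergentI)
  then obtain A B where A: "A > 0" "\<And>n. norm (\<alpha> n) \<le> A" and B: "B > 0" "\<And>n. norm (\<beta> n) \<le> B"
    unfolding Bseq_def by blast
  have pos: "e / B > 0" "e / A > 0"
    using e A B by auto
  obtain N1 where N1: "\<And>n. n \<ge> N1 \<Longrightarrow> \<alpha> n < e / B"
    using LIMSEQ_D[OF assms(1) pos(1)] by (auto simp: abs_less_iff)
  obtain N2 where N2: "\<And>n. n \<ge> N2 \<Longrightarrow> \<beta> n < e / A"
    using LIMSEQ_D[OF assms(2) pos(2)] by (auto simp: abs_less_iff)
  have "norm (max_convolution \<alpha> \<beta> n - 0) < e" if n: "n \<ge> N1 + N2" for n
  proof -
    have small: "\<alpha> k * \<beta> (n - k) < e" if "k \<le> n" for k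
    proof (cases "k \<ge> N1")
      case True
      have "\<alpha> k * \<beta> (n - k) \<le> \<alpha> k * B"
        using B(2)[of "n - k"] nonneg by (intro mult_left_mono) auto
      also have "\<dots> < e"
        using N1[OF True] B(1) by (simp add: field_simps)
      finally show ?thesis .
    next
      case False
      then have "n - k \<ge> N2"
        using n by simp
      have "\<alpha> k * \<beta> (n - k) \<le> A * \<beta> (n - k)"
        using A(2)[of k] nonneg by (intro mult_right_mono) auto
      also have "\<dots> < e"
        using N2[OF \<open>n - k \<ge> N2\<close>] A(1) by (simp add: field_simps)
      finally show ?thesis .
    qed
    have "max_convolution \<alpha> \<beta> n < e"
      unfolding max_convolution_def using small by (subst Max_less_iff) auto
    moreover have "0 \<le> max_convolution \<alpha> \<beta> n"
      using le_max_convolution[of 0 n \<alpha> \<beta>] nonneg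
      by (meson le0 mult_nonneg_nonneg order_trans)
    ultimately show ?thesis
      by simp
  qed
  then show "\<exists>no. \<forall>n\<ge>no. norm (max_convolution \<alpha> \<beta> n - 0) < e"
    by blast
qed

section \<open>Complete non-archimedean fields\<close>

text \<open>The arithmetic on \<^typ>\<open>'a\<close> and its metric are linked only by the locale assumptions, so
  the continuity of addition and multiplication is derived here from the ultrametric
  inequality.\<close>

locale complete_padic_field =
  fixes p :: nat and K :: "'a::{field_char_0,metric_space} itself"
  assumes prime_p: "prime p"
    and dist_eq: "dist (x::'a) y = padic_abs (x - y)"
    and abs_mult: "padic_abs (x * y :: 'a) = padic_abs x * padic_abs y"
    and abs_add: "padic_abs (x + y :: 'a) \<le> max (padic_abs x) (padic_abs y)"
    and abs_p: "padic_abs (of_nat p :: 'a) = 1 / real p"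
    and complete: "complete (UNIV :: 'a set)"
begin

lemma abs_nonneg [simp]: "0 \<le> padic_abs (x::'a)"
  by (simp add: padic_abs_def)

lemma abs_zero [simp]: "padic_abs (0::'a) = 0"
  by (simp add: padic_abs_def)

lemma abs_one [simp]: "padic_abs (1::'a) = 1"
proof -
  have "padic_abs (1::'a) \<noteq> 0"
    by (simp add: padic_abs_def)
  then show ?thesis
    using abs_mult[of 1 1] by simp
qed

lemma abs_minus [simp]: "padic_abs (- x :: 'a) = padic_abs x"
  using dist_commute[of x 0] by (simp add: dist_eq)

lemma abs_power: "padic_abs (x ^ n :: 'a) = padic_abs x ^ n"
  by (induction n) (auto simp: abs_mult)

lemma abs_sum_le:
  fixes f :: "'b \<Rightarrow> 'a"
  assumes "\<And>i. i \<in> A \<Longrightarrow> padic_abs (f i) \<le> B" "0 \<le> B"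
  shows "padic_abs (sum f A) \<le> B"
  using assms
proof (induction A rule: infinite_finite_induct)
  case (insert x A)
  then have "padic_abs (f x + sum f A) \<le> max (padic_abs (f x)) (padic_abs (sum f A))"
    by (intro abs_add)
  also have "\<dots> \<le> B"
    using insert by auto
  finally show ?case
    using insert by simp
qed auto

lemma abs_of_nat_le: "padic_abs (of_nat n :: 'a) \<le> 1"
proof -
  have "padic_abs (\<Sum>i<n. 1 :: 'a) \<le> 1"
    by (rule abs_sum_le) auto
  then show ?thesis
    by simp
qed

lemma tendsto_abs_iff: "(f \<longlongrightarrow> (l::'a)) F \<longleftrightarrow> ((\<lambda>x. padic_abs (f x - l)) \<longlongrightarrow> 0) F"
  by (subst tendsto_dist_iff) (simp add: dist_eq)

lemma tendsto_null_abs_iff: "(f \<longlongrightarrow> (0::'a)) F \<longleftrightarrow> ((\<lambda>x. padic_abs (f x)) \<longlongrightarrow> 0) F"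
  by (subst tendsto_abs_iff) simp

lemma tendsto_abs: "(f \<longlongrightarrow> (l::'a)) F \<Longrightarrow> ((\<lambda>x. padic_abs (f x)) \<longlongrightarrow> padic_abs l) F"
  unfolding padic_abs_def by (intro tendsto_intros)

lemma tendsto_plus:
  assumes "(f \<longlongrightarrow> (a::'a)) F" "(g \<longlongrightarrow> b) F"
  shows "((\<lambda>x. f x + g x) \<longlongrightarrow> a + b) F"
proof -
  have "((\<lambda>x. padic_abs (f x - a) + padic_abs (g x - b)) \<longlongrightarrow> 0 + 0) F"
    using assms by (intro tendsto_add) (auto simp: tendsto_abs_iff)
  then have lim: "((\<lambda>x. padic_abs (f x - a) + padic_abs (g x - b)) \<longlongrightarrow> 0) F"
    by simp
  have "padic_abs (f x + g x - (a + b)) \<le> padic_abs (f x - a) + padic_abs (g x - b)" for x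
    using abs_add[of "f x - a" "g x - b"] abs_nonneg[of "f x - a"] abs_nonneg[of "g x - b"]
    unfolding add_diff_add by linarith
  then show ?thesis
    unfolding tendsto_abs_iff[of _ "a + b"]
    by (intro tendsto_sandwich[OF _ _ tendsto_const lim]) auto
qed

lemma tendsto_times:
  assumes "(f \<longlongrightarrow> (a::'a)) F" "(g \<longlongrightarrow> b) F"
  shows "((\<lambda>x. f x * g x) \<longlongrightarrow> a * b) F"
proof -
  have "((\<lambda>x. padic_abs (f x) * padic_abs (g x - b) + padic_abs (f x - a) * padic_abs b)
      \<longlongrightarrow> padic_abs a * 0 + 0 * padic_abs b) F"
    using assms by (intro tendsto_add tendsto_mult tendsto_abs tendsto_const)
      (auto simp: tendsto_abs_iff)
  then have lim: "((\<lambda>x. padic_abs (f x) * padic_abs (g x - b) + padic_abs (f x - a) * padic_abs b)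
      \<longlongrightarrow> 0) F"
    by simp
  have "padic_abs (f x * g x - a * b)
      \<le> padic_abs (f x) * padic_abs (g x - b) + padic_abs (f x - a) * padic_abs b" for x
  proof -
    have "f x * g x - a * b = f x * (g x - b) + (f x - a) * b"
      by (simp add: algebra_simps)
    then show ?thesis
      using abs_add[of "f x * (g x - b)" "(f x - a) * b"]
      by (smt (verit) abs_mult abs_nonneg mult_nonneg_nonneg)
  qed
  then show ?thesis
    unfolding tendsto_abs_iff[of _ "a * b"]
    by (intro tendsto_sandwich[OF _ _ tendsto_const lim]) auto
qed

lemma continuous_on_plus:
  fixes f g :: "'a \<Rightarrow> 'a"
  assumes "continuous_on S f" "continuous_on S g"
  shows "continuous_on S (\<lambda>x. f x + g x)"
  using assms by (auto simp: continuous_on_def intro!: tendsto_plus)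

lemma continuous_on_times:
  fixes f g :: "'a \<Rightarrow> 'a"
  assumes "continuous_on S f" "continuous_on S g"
  shows "continuous_on S (\<lambda>x. f x * g x)"
  using assms by (auto simp: continuous_on_def intro!: tendsto_times)

lemma continuous_on_shift: "continuous_on S (\<lambda>x::'a. x + c)"
  by (intro continuous_on_plus continuous_intros)

lemma continuous_on_finite_sum:
  fixes f :: "'b \<Rightarrow> 'a \<Rightarrow> 'a"
  assumes "\<And>i. i \<in> A \<Longrightarrow> continuous_on S (f i)"
  shows "continuous_on S (\<lambda>x. \<Sum>i\<in>A. f i x)"
  using assms by (induction A rule: infinite_finite_induct) (auto intro!: continuous_on_plus)

lemma continuous_on_gbinomial: "continuous_on S (\<lambda>x::'a. x gchoose n)"
proof -
  have "continuous_on S (\<lambda>x::'a. \<Prod>i<n. x - of_nat i)"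
  proof (induction n)
    case (Suc n)
    then show ?case
      using continuous_on_times[OF Suc.IH continuous_on_shift[of S "- of_nat n"]] by simp
  qed simp
  from continuous_on_times[OF this continuous_on_const, of "inverse (fact n)"] show ?thesis
    by (simp add: gbinomial_prod_rev divide_inverse atLeast0LessThan)
qed

section \<open>Infinite series\<close>

lemma series_add:
  fixes f g :: "nat \<Rightarrow> 'a"
  assumes "f sums a" "g sums b"
  shows "(\<lambda>n. f n + g n) sums (a + b)"
  using assms unfolding sums_def by (simp add: sum.distrib tendsto_plus)

lemma series_mult:
  fixes f :: "nat \<Rightarrow> 'a"
  assumes "f sums a"
  shows "(\<lambda>n. c * f n) sums (c * a)"
  using assms unfolding sums_def
  by (simp flip: sum_distrib_left add: tendsto_times)

lemma series_unshift:
  fixes f :: "nat \<Rightarrow> 'a"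
  assumes "(\<lambda>n. f (Suc n)) sums a"
  shows "f sums (f 0 + a)"
proof -
  have "(\<lambda>N. f 0 + (\<Sum>n<N. f (Suc n))) \<longlonglongrightarrow> f 0 + a"
    using assms by (intro tendsto_plus tendsto_const) (simp add: sums_def)
  then have "(\<lambda>N. \<Sum>n<Suc N. f n) \<longlonglongrightarrow> f 0 + a"
    by (simp add: sum.lessThan_Suc_shift del: sum.lessThan_Suc)
  then show ?thesis
    unfolding sums_def by (rule LIMSEQ_imp_Suc)
qed

lemma dist_partial_sums_le:
  fixes f :: "nat \<Rightarrow> 'a"
  assumes "\<And>n. n \<ge> N \<Longrightarrow> padic_abs (f n) \<le> e" "0 \<le> e" "N \<le> i" "i \<le> j"
  shows "dist (\<Sum>n<i. f n) (\<Sum>n<j. f n) \<le> e"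
proof -
  have "dist (\<Sum>n<i. f n) (\<Sum>n<j. f n) = padic_abs (\<Sum>n\<in>{i..<j}. f n)"
    using sum_diff_nat_ivl[of 0 i j f] assms(4) dist_commute[of "\<Sum>n<i. f n"]
    by (simp add: dist_eq atLeast0LessThan)
  also have "\<dots> \<le> e"
    using assms by (intro abs_sum_le) auto
  finally show ?thesis .
qed

text \<open>In a complete non-archimedean field a series converges as soon as its terms tend to zero.\<close>

lemma summable_null:
  fixes f :: "nat \<Rightarrow> 'a"
  assumes "f \<longlonglongrightarrow> 0"
  shows "summable f"
proof -
  have "Cauchy (\<lambda>N. \<Sum>n<N. f n)"
  proof (rule metric_CauchyI)
    fix e :: real
    assume "e > 0"
    then obtain N where N: "\<And>n. n \<ge> N \<Longrightarrow> padic_abs (f n) < e / 2"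
      using metric_LIMSEQ_D[OF assms, of "e / 2"] by (auto simp: dist_eq)
    have *: "dist (\<Sum>n<i. f n) (\<Sum>n<j. f n) < e" if "N \<le> i" "i \<le> j" for i j
      using dist_partial_sums_le[of N f "e / 2" i j] N that \<open>e > 0\<close> by fastforce
    then have "dist (\<Sum>n<i. f n) (\<Sum>n<j. f n) < e" if "N \<le> i" "N \<le> j" for i j
      using *[of i j] *[of j i] that by (cases "i \<le> j") (auto simp: dist_commute)
    then show "\<exists>M. \<forall>m\<ge>M. \<forall>n\<ge>M. dist (\<Sum>n<m. f n) (\<Sum>n<n. f n) < e"
      by blast
  qed
  then show ?thesis
    using complete unfolding complete_def summable_def sums_def by blast
qed

lemma summable_dominated:
  fixes f :: "nat \<Rightarrow> 'a"
  assumes "\<And>n. padic_abs (f n) \<le> M n" "M \<longlonglongrightarrow> 0"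
  shows "summable f"
proof -
  have "f \<longlonglongrightarrow> 0"
    unfolding tendsto_null_abs_iff
    by (rule tendsto_sandwich[OF _ _ tendsto_const assms(2)]) (auto simp: assms(1))
  then show ?thesis
    by (rule summable_null)
qed

text \<open>The ultrametric analogue of the Weierstrass M-test: here the bounds only have to tend to
  zero.\<close>

lemma continuous_on_series:
  fixes f :: "nat \<Rightarrow> 'a \<Rightarrow> 'a"
  assumes cont: "\<And>n. continuous_on S (f n)"
    and bound: "\<And>n x. x \<in> S \<Longrightarrow> padic_abs (f n x) \<le> M n"
    and "M \<longlonglongrightarrow> 0"
  shows "continuous_on S (\<lambda>x. \<Sum>n. f n x)"
proof (rule uniform_limit_theorem)
  show "\<forall>\<^sub>F N in sequentially. continuous_on S (\<lambda>x. \<Sum>n<N. f n x)"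
    using cont by (auto intro!: always_eventually continuous_on_finite_sum)
  show "uniform_limit S (\<lambda>N x. \<Sum>n<N. f n x) (\<lambda>x. \<Sum>n. f n x) sequentially"
  proof (rule uniform_limitI)
    fix e :: real
    assume "e > 0"
    then obtain N where N: "\<And>n. n \<ge> N \<Longrightarrow> M n < e / 2"
      using LIMSEQ_D[OF assms(3), of "e / 2"] by (force simp: abs_less_iff)
    have "dist (\<Sum>n<i. f n x) (\<Sum>n. f n x) < e" if "i \<ge> N" "x \<in> S" for i x
    proof -
      have "summable (\<lambda>n. f n x)"
        using bound[OF that(2)] assms(3) by (rule summable_dominated)
      then have "(\<lambda>j. \<Sum>n<j. f n x) \<longlonglongrightarrow> (\<Sum>n. f n x)"
        by (rule summable_LIMSEQ)
      then have "(\<lambda>j. dist (\<Sum>n<i. f n x) (\<Sum>n<j. f n x)) \<longlonglongrightarrow> dist (\<Sum>n<i. f n x) (\<Sum>n. f n x)"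
        by (intro tendsto_intros)
      moreover have "dist (\<Sum>n<i. f n x) (\<Sum>n<j. f n x) \<le> e / 2" if "j \<ge> i" for j
      proof (rule dist_partial_sums_le)
        show "padic_abs (f n x) \<le> e / 2" if "n \<ge> N" for n
          using bound[OF \<open>x \<in> S\<close>, of n] N[OF that] by linarith
      qed (use \<open>e > 0\<close> \<open>i \<ge> N\<close> that in auto)
      ultimately have "dist (\<Sum>n<i. f n x) (\<Sum>n. f n x) \<le> e / 2"
        by (intro LIMSEQ_le_const2) auto
      then show ?thesis
        using \<open>e > 0\<close> by linarith
    qed
    then show "\<forall>\<^sub>F i in sequentially. \<forall>x\<in>S. dist (\<Sum>n<i. f n x) (\<Sum>n. f n x) < e"
      unfolding eventually_sequentially by blast
  qed
qed simp

section \<open>The p-adic integers\<close>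

lemma abs_p_power_null: "(\<lambda>n. padic_abs (of_nat p ^ n :: 'a)) \<longlonglongrightarrow> 0"
proof -
  have "1 / real p < 1"
    using prime_gt_1_nat[OF prime_p] by simp
  then show ?thesis
    by (simp add: abs_power abs_p LIMSEQ_power_zero)
qed

lemma of_int_in_Zp [simp]: "(of_int n :: 'a) \<in> Zp"
  unfolding Zp_def using closure_subset by force

lemma of_nat_in_Zp [simp]: "(of_nat n :: 'a) \<in> Zp"
  using of_int_in_Zp[of "int n"] by simp

lemma Zp_add_int:
  assumes "(x::'a) \<in> Zp"
  shows "x + of_int m \<in> Zp"
proof -
  obtain y where y: "\<And>n. y n \<in> \<int>" "y \<longlonglongrightarrow> x"
    using assms unfolding Zp_def closure_sequential by blast
  have "(\<lambda>n. y n + of_int m) \<longlonglongrightarrow> x + of_int m"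
    using y(2) by (intro tendsto_plus tendsto_const)
  moreover have "y n + of_int m \<in> \<int>" for n
    using y(1) by simp
  ultimately show ?thesis
    unfolding Zp_def closure_sequential by (intro exI[of _ "\<lambda>n. y n + of_int m"]) simp
qed

lemma Zp_add_1: "(x::'a) \<in> Zp \<Longrightarrow> x + 1 \<in> Zp"
  using Zp_add_int[of x 1] by simp

lemma Zp_diff_1: "(x::'a) \<in> Zp \<Longrightarrow> x - 1 \<in> Zp"
  using Zp_add_int[of x "- 1"] by simp

text \<open>A negative integer \<open>z\<close> is the limit of the integers \<open>z + \<bar>z\<bar> p\<^sup>n\<close>, which are natural
  numbers.\<close>

lemma Zp_eq_closure_Nats: "(Zp :: 'a set) = closure \<nat>"
proof
  show "closure \<nat> \<subseteq> (Zp :: 'a set)"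
    unfolding Zp_def by (intro closure_mono Nats_subset_Ints)
  have "\<int> \<subseteq> closure (\<nat> :: 'a set)"
  proof
    fix x :: 'a
    assume "x \<in> \<int>"
    then obtain z where x: "x = of_int z"
      by (elim Ints_cases)
    have "(\<lambda>n. x + of_int \<bar>z\<bar> * of_nat p ^ n) \<longlonglongrightarrow> x + of_int \<bar>z\<bar> * 0"
      by (intro tendsto_plus tendsto_times tendsto_const)
        (simp add: tendsto_null_abs_iff abs_p_power_null)
    moreover have "x + of_int \<bar>z\<bar> * of_nat p ^ n \<in> \<nat>" for n
    proof -
      have "1 \<le> int p ^ n"
        using prime_gt_0_nat[OF prime_p] by simp
      then have "\<bar>z\<bar> * 1 \<le> \<bar>z\<bar> * int p ^ n"
        by (intro mult_left_mono) auto
      then have "0 \<le> z + \<bar>z\<bar> * int p ^ n"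
        by linarith
      then have "x + of_int \<bar>z\<bar> * of_nat p ^ n = of_nat (nat (z + \<bar>z\<bar> * int p ^ n))"
        by (simp add: x of_nat_nat)
      then show ?thesis
        by (metis of_nat_in_Nats)
    qed
    ultimately show "x \<in> closure \<nat>"
      unfolding closure_sequential
      by (intro exI[of _ "\<lambda>n. x + of_int \<bar>z\<bar> * of_nat p ^ n"]) simp
  qed
  then show "(Zp :: 'a set) \<subseteq> closure \<nat>"
    unfolding Zp_def by (rule closure_minimal) simp
qed

text \<open>At natural numbers the binomial coefficients are natural numbers, and the bound passes to
  the closure.\<close>

lemma abs_gbinomial_le:
  assumes "(x::'a) \<in> Zp"
  shows "padic_abs (x gchoose n) \<le> 1"
proof -
  obtain y where y: "\<And>i. y i \<in> \<nat>" "y \<longlonglongrightarrow> x"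
    using assms unfolding Zp_eq_closure_Nats closure_sequential by blast
  have "isCont (\<lambda>x::'a. x gchoose n) x"
    using continuous_on_gbinomial[of UNIV n] by (simp add: continuous_on_eq_continuous_at)
  then have "(\<lambda>i. y i gchoose n) \<longlonglongrightarrow> (x gchoose n)"
    using y(2) by (rule isCont_tendsto_compose)
  from tendsto_abs[OF this] have "(\<lambda>i. padic_abs (y i gchoose n)) \<longlonglongrightarrow> padic_abs (x gchoose n)" .
  moreover have "padic_abs (y i gchoose n) \<le> 1" for i
  proof -
    obtain m where "y i = of_nat m"
      using y(1) Nats_cases by blast
    then show ?thesis
      using abs_of_nat_le[of "m choose n"] by (simp add: binomial_gbinomial)
  qed
  ultimately show ?thesis
    by (intro LIMSEQ_le_const2) auto
qed

text \<open>For \<open>n \<ge> p\<^sup>k\<close> the factorial of \<open>n\<close> is divisible by \<open>p\<^sup>k\<close>.\<close>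

lemma abs_fact_null: "(\<lambda>n. padic_abs (fact n :: 'a)) \<longlonglongrightarrow> 0"
proof (rule LIMSEQ_I)
  fix e :: real
  assume "e > 0"
  then obtain k where k: "padic_abs (of_nat p ^ k :: 'a) < e"
    using LIMSEQ_D[OF abs_p_power_null] by fastforce
  have "padic_abs (fact n :: 'a) < e" if "n \<ge> p ^ k" for n
  proof -
    have "p ^ k dvd fact n"
      using that prime_gt_0_nat[OF prime_p] by (intro dvd_fact) auto
    then obtain m where "fact n = p ^ k * m"
      by (elim dvdE)
    then have "(fact n :: 'a) = of_nat p ^ k * of_nat m"
      by (metis of_nat_fact of_nat_mult of_nat_power)
    then have "padic_abs (fact n :: 'a) \<le> padic_abs (of_nat p ^ k :: 'a)"
      by (simp add: abs_mult mult_left_le abs_of_nat_le)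
    then show ?thesis
      using k by linarith
  qed
  then show "\<exists>no. \<forall>n\<ge>no. norm (padic_abs (fact n :: 'a) - 0) < e"
    by auto
qed

section \<open>Mahler coefficients and the star product\<close>

lemma mahler_series_summable:
  assumes "a \<longlonglongrightarrow> (0::'a)" "x \<in> Zp"
  shows "summable (\<lambda>n. a n * (x gchoose n))"
proof (rule summable_dominated)
  show "padic_abs (a n * (x gchoose n)) \<le> padic_abs (a n)" for n
    by (simp add: abs_mult mult_left_le abs_gbinomial_le assms(2))
  show "(\<lambda>n. padic_abs (a n)) \<longlonglongrightarrow> 0"
    using assms(1) by (simp add: tendsto_null_abs_iff)
qed

text \<open>At \<open>x = m\<close> a Mahler series is a finite sum in which \<open>a m\<close> appears with coefficient 1, so
  the values at the natural numbers determine the coefficients recursively.\<close>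

lemma mahler_coeffs_unique:
  fixes a b :: "nat \<Rightarrow> 'a"
  assumes "\<And>x. x \<in> Zp \<Longrightarrow> (\<lambda>n. a n * (x gchoose n)) sums \<phi> x"
    and "\<And>x. x \<in> Zp \<Longrightarrow> (\<lambda>n. b n * (x gchoose n)) sums \<phi> x"
  shows "a = b"
proof
  fix m
  show "a m = b m"
  proof (induction m rule: less_induct)
    case (less m)
    have value_at_nat: "\<phi> (of_nat m) = (\<Sum>n<m. c n * of_nat (m choose n)) + c m"
      if "\<And>x. x \<in> Zp \<Longrightarrow> (\<lambda>n. c n * (x gchoose n)) sums \<phi> x" for c :: "nat \<Rightarrow> 'a"
    proof -
      have "(\<lambda>n. c n * of_nat (m choose n)) sums (\<Sum>n\<le>m. c n * of_nat (m choose n))"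
        by (rule sums_finite) auto
      then have "\<phi> (of_nat m) = (\<Sum>n\<le>m. c n * of_nat (m choose n))"
        using that[of "of_nat m"] by (auto simp: binomial_gbinomial intro: sums_unique2)
      then show ?thesis
        by (simp flip: lessThan_Suc_atMost)
    qed
    have "(\<Sum>n<m. a n * of_nat (m choose n)) = (\<Sum>n<m. b n * of_nat (m choose n))"
      using less.IH by simp
    then show ?case
      using value_at_nat[OF assms(1)] value_at_nat[OF assms(2)] by simp
  qed
qed

lemma mahler_coeff_series:
  assumes "a \<longlonglongrightarrow> (0::'a)"
  shows "mahler_coeff (\<lambda>x\<in>Zp. \<Sum>n. a n * (x gchoose n)) = a"
  unfolding mahler_coeff_def
proof (rule the_equality)
  have sums: "(\<lambda>n. a n * (x gchoose n)) sums (\<lambda>x\<in>Zp. \<Sum>n. a n * (x gchoose n)) x"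
    if "x \<in> Zp" for x
    using mahler_series_summable[OF assms that] that by (simp add: summable_sums)
  then show "a \<longlonglongrightarrow> 0 \<and>
      (\<forall>x\<in>Zp. (\<lambda>n. a n * (x gchoose n)) sums (\<lambda>x\<in>Zp. \<Sum>n. a n * (x gchoose n)) x)"
    using assms by blast
  show "b = a" if "b \<longlonglongrightarrow> 0 \<and>
      (\<forall>x\<in>Zp. (\<lambda>n. b n * (x gchoose n)) sums (\<lambda>x\<in>Zp. \<Sum>n. a n * (x gchoose n)) x)" for b
    by (rule mahler_coeffs_unique) (use that sums in auto)
qed

lemma abs_binomial_convolution_le:
  fixes a b :: "nat \<Rightarrow> 'a"
  assumes "\<And>n. padic_abs (a n) \<le> \<alpha> n" "\<And>n. padic_abs (b n) \<le> \<beta> n"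
  shows "padic_abs (\<Sum>k\<le>n. of_nat (n choose k) * a k * b (n - k)) \<le> max_convolution \<alpha> \<beta> n"
proof (rule abs_sum_le)
  have nonneg: "0 \<le> \<alpha> k" "0 \<le> \<beta> k" for k
    using assms abs_nonneg order_trans by blast+
  show le: "padic_abs (of_nat (n choose k) * a k * b (n - k)) \<le> max_convolution \<alpha> \<beta> n"
    if "k \<in> {..n}" for k
  proof -
    have "padic_abs (of_nat (n choose k) * a k * b (n - k))
        = padic_abs (of_nat (n choose k) :: 'a) * (padic_abs (a k) * padic_abs (b (n - k)))"
      by (simp add: abs_mult)
    also have "\<dots> \<le> 1 * (\<alpha> k * \<beta> (n - k))"
      using assms nonneg by (intro mult_mono abs_of_nat_le) auto
    also have "\<dots> \<le> max_convolution \<alpha> \<beta> n"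
      using that by (simp add: le_max_convolution)
    finally show ?thesis .
  qed
  show "0 \<le> max_convolution \<alpha> \<beta> n"
    using le[of 0] abs_nonneg order_trans by blast
qed

lemma mahler_coeff_star:
  fixes \<phi> \<psi> :: "'a \<Rightarrow> 'a"
  assumes "mahler_coeff \<phi> \<longlonglongrightarrow> 0" "mahler_coeff \<psi> \<longlonglongrightarrow> 0"
  shows "mahler_coeff (\<phi> \<star> \<psi>) =
    (\<lambda>n. \<Sum>k\<le>n. of_nat (n choose k) * mahler_coeff \<phi> k * mahler_coeff \<psi> (n - k))"
  unfolding star_def atLeast0AtMost
proof (rule mahler_coeff_series)
  let ?M = "max_convolution (\<lambda>n. padic_abs (mahler_coeff \<phi> n)) (\<lambda>n. padic_abs (mahler_coeff \<psi> n))"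
  have "?M \<longlonglongrightarrow> 0"
    using assms by (intro max_convolution_null) (auto simp: tendsto_null_abs_iff)
  then show "(\<lambda>n. \<Sum>k\<le>n. of_nat (n choose k) * mahler_coeff \<phi> k * mahler_coeff \<psi> (n - k)) \<longlonglongrightarrow> 0"
    unfolding tendsto_null_abs_iff
    by (intro tendsto_sandwich[OF _ _ tendsto_const \<open>?M \<longlonglongrightarrow> 0\<close>])
      (auto intro!: always_eventually abs_binomial_convolution_le)
qed

lemma mahler_coeff_one_minus_beta1_star_power:
  assumes "(s::'a) \<in> Zp"
  shows "mahler_coeff (one_minus_beta1_star_power s) = (\<lambda>n. (- 1) ^ n * (s gchoose n) * fact n)"
    and "(\<lambda>n. (- 1) ^ n * (s gchoose n) * fact n) \<longlonglongrightarrow> 0"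
proof -
  have le: "padic_abs ((- 1) ^ n * (s gchoose n) * fact n) \<le> padic_abs (fact n :: 'a)" for n
    using abs_gbinomial_le[OF assms, of n]
    by (simp add: abs_mult abs_power mult_left_le_one_le)
  show null: "(\<lambda>n. (- 1) ^ n * (s gchoose n) * fact n) \<longlonglongrightarrow> 0"
    unfolding tendsto_null_abs_iff
    by (rule tendsto_sandwich[OF _ _ tendsto_const abs_fact_null]) (auto simp: le)
  show "mahler_coeff (one_minus_beta1_star_power s) = (\<lambda>n. (- 1) ^ n * (s gchoose n) * fact n)"
    unfolding one_minus_beta1_star_power_def by (rule mahler_coeff_series[OF null])
qed

lemma power_null:
  assumes "padic_abs (u::'a) < 1"
  shows "(\<lambda>n. u ^ n) \<longlonglongrightarrow> 0"
  unfolding tendsto_null_abs_iff using assms by (simp add: abs_power LIMSEQ_power_zero)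

lemma mahler_coeff_g_fun:
  assumes "padic_abs (r - 1 :: 'a) < 1"
  shows "mahler_coeff (g_fun r) = (\<lambda>n. (r - 1) ^ n)"
  unfolding g_fun_def by (rule mahler_coeff_series[OF power_null[OF assms]])

lemma H_fps_const_one_nth: "fps_nth (H_fps (const_one :: 'a \<Rightarrow> 'a)) n = (- 1) ^ n"
  using of_int_in_Zp[of "- 1 - int n"] by (simp add: H_fps_def const_one_def)

section \<open>The power function\<close>

lemma g_fun_sums:
  assumes "padic_abs (r - 1 :: 'a) < 1" "x \<in> Zp"
  shows "(\<lambda>n. (r - 1) ^ n * (x gchoose n)) sums g_fun r x"
  using mahler_series_summable[OF power_null[OF assms(1)] assms(2)] assms(2)
  by (simp add: g_fun_def summable_sums)

lemma g_fun_add_1: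
  assumes "padic_abs (r - 1 :: 'a) < 1" "x \<in> Zp"
  shows "g_fun r (x + 1) = r * g_fun r x"
proof -
  let ?f = "\<lambda>n. (r - 1) ^ n * (x gchoose n)"
  let ?h = "\<lambda>n. (r - 1) ^ n * ((x + 1) gchoose n)"
  have f: "?f sums g_fun r x"
    by (rule g_fun_sums[OF assms])
  have "(\<lambda>n. if n = 0 then 0 else (r - 1) * ?f (n - 1)) sums (0 + (r - 1) * g_fun r x)"
    using series_unshift[of "\<lambda>n. if n = 0 then 0 else (r - 1) * ?f (n - 1)"
        "(r - 1) * g_fun r x"] series_mult[OF f, of "r - 1"] by simp
  from series_add[OF f this]
  have "(\<lambda>n. ?f n + (if n = 0 then 0 else (r - 1) * ?f (n - 1))) sums (r * g_fun r x)"
    by (simp add: algebra_simps)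
  also have "(\<lambda>n. ?f n + (if n = 0 then 0 else (r - 1) * ?f (n - 1))) = ?h"
  proof
    fix n
    show "?f n + (if n = 0 then 0 else (r - 1) * ?f (n - 1)) = ?h n"
      by (cases n) (simp_all add: gbinomial_Suc_Suc distrib_left mult_ac)
  qed
  finally have "?h sums (r * g_fun r x)" .
  then show ?thesis
    using g_fun_sums[OF assms(1) Zp_add_1[OF assms(2)]] by (rule sums_unique2[symmetric])
qed

lemma continuous_on_g_fun:
  assumes "padic_abs (r - 1 :: 'a) < 1"
  shows "continuous_on Zp (g_fun r)"
proof -
  have "continuous_on Zp (\<lambda>x::'a. \<Sum>n. (r - 1) ^ n * (x gchoose n))"
  proof (rule continuous_on_series)
    show "continuous_on Zp (\<lambda>x::'a. (r - 1) ^ n * (x gchoose n))" for n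
      by (intro continuous_on_times continuous_on_const continuous_on_gbinomial)
    show "padic_abs ((r - 1) ^ n * (x gchoose n)) \<le> padic_abs ((r - 1) ^ n)"
      if "x \<in> Zp" for n and x :: 'a
      by (simp add: abs_mult mult_left_le abs_gbinomial_le that)
    show "(\<lambda>n. padic_abs ((r - 1) ^ n)) \<longlonglongrightarrow> 0"
      using power_null[OF assms] by (simp add: tendsto_null_abs_iff)
  qed
  then show ?thesis
    by (simp add: g_fun_def cong: continuous_on_cong)
qed

section \<open>The moment series\<close>

text \<open>The numbers \<open>(x gchoose k) * fact k\<close> are the coefficients of the exponential generating
  function \<open>(1 + t)\<^sup>x\<close>, hence those defined here belong to \<open>(1 + t)\<^sup>x exp (u t)\<close>.\<close>

definition moment_term :: "'a \<Rightarrow> 'a \<Rightarrow> nat \<Rightarrow> 'a"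
  where "moment_term u x n =
    (\<Sum>k\<le>n. of_nat (n choose k) * ((x gchoose k) * fact k) * u ^ (n - k))"

lemma moment_term_0 [simp]: "moment_term u x 0 = 1"
  by (simp add: moment_term_def)

lemma moment_term_Suc:
  "moment_term u x (Suc n) = u * moment_term u x n + x * moment_term u (x - 1) n"
proof -
  have "(x gchoose Suc k) * fact (Suc k) = x * (((x - 1) gchoose k) * fact k)" for k
    using arg_cong[OF gbinomial_absorption[of k x], of "\<lambda>y. fact k * y"]
    by (simp add: algebra_simps)
  then show ?thesis
    unfolding moment_term_def binomial_convolution_Suc
    by (simp add: sum_distrib_left mult_ac)
qed

definition moment_bound :: "'a \<Rightarrow> nat \<Rightarrow> real"
  where "moment_bound u =
    max_convolution (\<lambda>n. padic_abs (fact n :: 'a)) (\<lambda>n. padic_abs (u ^ n))"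

lemma moment_bound_null: "padic_abs u < 1 \<Longrightarrow> moment_bound u \<longlonglongrightarrow> 0"
  unfolding moment_bound_def using power_null[of u]
  by (intro max_convolution_null abs_fact_null) (auto simp: tendsto_null_abs_iff)

lemma abs_moment_term_le: "x \<in> Zp \<Longrightarrow> padic_abs (moment_term u x n) \<le> moment_bound u n"
  unfolding moment_term_def moment_bound_def
  by (rule abs_binomial_convolution_le)
    (auto simp: abs_mult abs_gbinomial_le mult_left_le_one_le)

lemma moment_series_sums:
  assumes "padic_abs u < 1" "x \<in> Zp"
  shows "moment_term u x sums (\<Sum>n. moment_term u x n)"
  by (rule summable_sums, rule summable_dominated[OF abs_moment_term_le moment_bound_null])
    (use assms in auto)

text \<open>This is the recursion \<open>moment_term_Suc\<close> summed over \<open>n\<close>: its left-hand side contributes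
  the whole series except the initial term 1. It is the counterpart of integration by parts.\<close>

lemma moment_series_functional_equation:
  assumes "padic_abs u < 1" "x \<in> Zp"
  shows "(1 - u) * (\<Sum>n. moment_term u x n) = 1 + x * (\<Sum>n. moment_term u (x - 1) n)"
proof -
  let ?I = "\<lambda>x. \<Sum>n. moment_term u x n"
  have "(\<lambda>n. moment_term u x (Suc n)) sums (u * ?I x + x * ?I (x - 1))"
    unfolding moment_term_Suc
    by (intro series_add series_mult moment_series_sums Zp_diff_1 assms)
  from series_unshift[OF this] have "?I x = 1 + (u * ?I x + x * ?I (x - 1))"
    using moment_series_sums[OF assms] by (auto intro: sums_unique2)
  then show ?thesis
    by (simp add: algebra_simps)
qed

lemma continuous_on_moment_series:
  assumes "padic_abs u < 1"
  shows "continuous_on Zp (\<lambda>x. \<Sum>n. moment_term u x n)"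
proof (rule continuous_on_series)
  show "continuous_on Zp (\<lambda>x. moment_term u x n)" for n
    unfolding moment_term_def
    by (intro continuous_on_finite_sum continuous_on_times continuous_on_const
        continuous_on_gbinomial)
  show "padic_abs (moment_term u x n) \<le> moment_bound u n" if "x \<in> Zp" for n x
    using that by (rule abs_moment_term_le)
  show "moment_bound u \<longlonglongrightarrow> 0"
    using assms by (rule moment_bound_null)
qed

text \<open>Integration against \<open>\<mu>(H\<^sub>1)\<close> multiplies the n-th Mahler coefficient by \<open>(-1)\<^sup>n\<close>, that is,
  it replaces \<open>t\<close> by \<open>- t\<close> in the generating function; this turns \<open>(1 - t)\<^sup>s exp ((r - 1) t)\<close>
  into \<open>(1 + t)\<^sup>s exp ((1 - r) t)\<close>.\<close>

lemma integral_star_power_eq_moment_series: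
  assumes "padic_abs (r - 1 :: 'a) < 1" "s \<in> Zp"
  shows "integral_mu (H_fps const_one) (one_minus_beta1_star_power s \<star> g_fun r) =
    (\<Sum>n. moment_term (1 - r) s n)"
proof -
  have "mahler_coeff (one_minus_beta1_star_power s \<star> g_fun r) n * (- 1) ^ n =
      moment_term (1 - r) s n" for n
  proof -
    have "mahler_coeff (one_minus_beta1_star_power s \<star> g_fun r) =
        (\<lambda>n. \<Sum>k\<le>n. of_nat (n choose k) * ((- 1) ^ k * (s gchoose k) * fact k) * (r - 1) ^ (n - k))"
      using mahler_coeff_star[of "one_minus_beta1_star_power s" "g_fun r"]
        mahler_coeff_one_minus_beta1_star_power[OF assms(2)]
        mahler_coeff_g_fun[OF assms(1)] power_null[OF assms(1)]
      by simp
    moreover have "of_nat (n choose k) * ((- 1) ^ k * (s gchoose k) * fact k) * (r - 1) ^ (n - k)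
        * (- 1) ^ n = of_nat (n choose k) * ((s gchoose k) * fact k) * (1 - r) ^ (n - k)"
      if "k \<le> n" for k
    proof -
      have "(- 1 :: 'a) ^ n = (- 1) ^ k * (- 1) ^ (n - k)"
        using that by (simp flip: power_add)
      moreover have "(1 - r) ^ (n - k) = (- 1) ^ (n - k) * (r - 1) ^ (n - k)"
        by (simp flip: power_mult_distrib)
      moreover have "(- 1 :: 'a) ^ k * (- 1) ^ k = 1"
        by (simp flip: power_mult_distrib)
      ultimately show ?thesis
        by (simp add: mult_ac)
    qed
    ultimately show ?thesis
      unfolding moment_term_def by (simp only: sum_distrib_right) (intro sum.cong, auto)
  qed
  then show ?thesis
    by (simp add: integral_mu_def H_fps_const_one_nth)
qed

section \<open>Inverting the operator\<close>

text \<open>If \<open>\<phi>\<close> and \<open>\<psi>\<close> have the same image, they agree at 0, where the second term of the operator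
  vanishes, and then inductively at every natural number; continuity does the rest.\<close>

lemma inj_on_S_op: "inj_on S_op (C_Zp :: ('a \<Rightarrow> 'a) set)"
proof (rule inj_onI)
  fix \<phi> \<psi> :: "'a \<Rightarrow> 'a"
  assume \<phi>: "\<phi> \<in> C_Zp" and \<psi>: "\<psi> \<in> C_Zp" and eq: "S_op \<phi> = S_op \<psi>"
  have S: "\<phi> x - x * \<phi> (x - 1) = \<psi> x - x * \<psi> (x - 1)" if "x \<in> Zp" for x
    using fun_cong[OF eq, of x] that by (simp add: S_op_def)
  have nat: "\<phi> (of_nat n) = \<psi> (of_nat n)" for n
  proof (induction n)
    case 0
    then show ?case
      using S[of 0] of_nat_in_Zp[of 0] by simp
  next
    case (Suc n)
    then show ?case
      using S[of "of_nat (Suc n)"] of_nat_in_Zp[of "Suc n"] by simp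
  qed
  have "\<phi> x = \<psi> x" if x: "x \<in> Zp" for x
  proof -
    obtain y where y: "\<And>i. y i \<in> \<nat>" "y \<longlonglongrightarrow> x"
      using x unfolding Zp_eq_closure_Nats closure_sequential by blast
    have yZ: "y i \<in> Zp" for i
      using y(1)[of i] by (auto elim: Nats_cases)
    have cont: "continuous_on Zp \<phi>" "continuous_on Zp \<psi>"
      using \<phi> \<psi> by (auto simp: C_Zp_def)
    have "(\<lambda>i. \<phi> (y i)) \<longlonglongrightarrow> \<phi> x"
      using continuous_on_tendsto_compose[OF cont(1) y(2) x] yZ by simp
    moreover have "(\<lambda>i. \<psi> (y i)) \<longlonglongrightarrow> \<psi> x"
      using continuous_on_tendsto_compose[OF cont(2) y(2) x] yZ by simp
    moreover have "\<phi> (y i) = \<psi> (y i)" for i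
      using y(1)[of i] nat by (auto elim: Nats_cases)
    ultimately show ?thesis
      by (simp add: LIMSEQ_unique)
  qed
  moreover have "\<phi> \<in> extensional Zp" "\<psi> \<in> extensional Zp"
    using \<phi> \<psi> by (auto simp: C_Zp_def)
  ultimately show "\<phi> = \<psi>"
    by (intro extensionalityI)
qed

lemma gamma_fun_eq:
  assumes r: "padic_abs (r - 1 :: 'a) < 1"
  shows "gamma_fun r = (\<lambda>x\<in>Zp. g_fun r (x + 1) * (\<Sum>n. moment_term (1 - r) x n))"
    (is "_ = ?F")
proof -
  have u: "padic_abs (1 - r) < 1"
    using r abs_minus[of "r - 1"] by simp
  have "continuous_on Zp (\<lambda>x. g_fun r (x + 1))"
    using continuous_on_compose2[OF continuous_on_g_fun[OF r] continuous_on_shift] Zp_add_1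
    by blast
  then have "continuous_on Zp (\<lambda>x. g_fun r (x + 1) * (\<Sum>n. moment_term (1 - r) x n))"
    by (intro continuous_on_times continuous_on_moment_series u)
  then have "?F \<in> C_Zp"
    by (simp add: C_Zp_def cong: continuous_on_cong)
  moreover have "S_op ?F = g_fun r"
  proof
    fix x
    show "S_op ?F x = g_fun r x"
    proof (cases "x \<in> Zp")
      case True
      let ?I = "\<lambda>x. \<Sum>n. moment_term (1 - r) x n"
      have "S_op ?F x = g_fun r (x + 1) * ?I x - x * (g_fun r x * ?I (x - 1))"
        using True by (simp add: S_op_def Zp_diff_1)
      also have "\<dots> = g_fun r x * (r * ?I x - x * ?I (x - 1))"
        unfolding g_fun_add_1[OF r True] by (simp add: algebra_simps)
      also have "r * ?I x - x * ?I (x - 1) = 1"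
        using moment_series_functional_equation[OF u True] by simp
      finally show ?thesis
        by (simp only: mult_1_right)
    qed (simp add: S_op_def g_fun_def)
  qed
  ultimately show ?thesis
    unfolding gamma_fun_def using inv_into_f_eq[OF inj_on_S_op] by blast
qed

end

section \<open>The formula for the Gamma function\<close>

theorem proposition6p12:
  fixes p :: nat and r s :: "'a::{field_char_0,metric_space}"
  assumes "prime p"
    and "padic_complex_numbers TYPE('a) p"
    and "padic_abs (r - 1) < 1"
    and "s \<in> Zp"
  shows "padic_Gamma p r s =
    padic_exp (r * of_nat (p_tilde p)) * g_fun r s *
      integral_mu (H_fps const_one) (one_minus_beta1_star_power (s - 1) \<star> g_fun r)"
proof -
  interpret complete_padic_field p "TYPE('a)"
    using assms(1,2) by (simp add: complete_padic_field_def padic_complex_numbers_def)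
  have "s - 1 \<in> Zp"
    using assms(4) by (rule Zp_diff_1)
  then show ?thesis
    using assms(4)
    by (simp add: padic_Gamma_def gamma_fun_eq[OF assms(3)]
        integral_star_power_eq_moment_series[OF assms(3)])
qed

end
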